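(* Let $\Omega$ be an uncountable locally compact Polish space and let $\kappa$ be an ordinal of cardinality $\mathfrak{c}$. Then there exists a well-ordered increasing chain $(\mathcal{Q}_\alpha:\alpha\in\kappa)$ of prime $z$-filters on $\Omega$. Furthermore, (for this chain) by setting $Q_\alpha=C_0(\Omega)\cap\mathbf{Z}^{-1}[\mathcal{Q}_\alpha]$ one obtains a well-ordered increasing chain $(Q_\alpha:\alpha\in\kappa)$ of prime $z$-ideals in $C_0(\Omega)$.
   Context: $\mathfrak{c}=2^{\aleph_0}$. A Polish space is a separable completely metrizable space. A well-ordered increasing chain indexed by an ordinal $\kappa$ means a family with $\mathcal{Q}_\alpha\subsetneq\mathcal{Q}_\beta$ whenever $\alpha<\beta$ in $\kappa$. $C(\Omega)$ is the algebra of continuous scalar-valued functions on $\Omega$ and $C_0(\Omega)$ the subalgebra of those vanishing at infinity (scalar field real or complex, fixed). $\mathbf{Z}(f)=f^{-1}(0)$ and $\mathbf{Z}[\Omega]=\{\mathbf{Z}(f):f\in C(\Omega)\}$. A $z$-filter on $\Omega$ is a non-empty proper subset of $\mathbf{Z}[\Omega]$ closed under finite intersections and under supersets belonging to $\mathbf{Z}[\Omega]$. A $z$-filter $\mathcal{P}$ is prime if $Z_1\cup Z_2\notin\mathcal{P}$ whenever $Z_1,Z_2\in\mathbf{Z}[\Omega]\setminus\mathcal{P}$. For a $z$-filter $\mathcal{F}$, $\mathbf{Z}^{-1}[\mathcal{F}]=\{f\in C(\Omega):\mathbf{Z}(f)\in\mathcal{F}\}$. An ideal $I$ of $C_0(\Omega)$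 is a $z$-ideal if $g\in I$ whenever $g\in C_0(\Omega)$, $f\in I$ and $\mathbf{Z}(g)\supset\mathbf{Z}(f)$. Prime ideals are proper. *)

theory Defs
  imports "HOL-Analysis.Analysis"
begin

text \<open>
  A space \<open>\<Omega>\<close> is an abstract topology \<open>X\<close>; the scalars are a type of class
  \<^class>\<open>real_normed_field\<close>, which by the Gelfand--Mazur theorem means the real or the complex
  numbers (up to isometric isomorphism).
\<close>

definition polish_topology :: "'a topology \<Rightarrow> bool" where
  "polish_topology X \<longleftrightarrow> separable_space X \<and> completely_metrizable_space X"

text \<open>
  Scalar-valued functions on \<open>topspace X\<close> are represented by total functions that are \<open>0\<close> off
  \<open>topspace X\<close>. So distinct elements of \<open>cfun X\<close> differ on \<open>topspace X\<close>, and the algebra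
  operations are the pointwise ones.
\<close>

definition cfun :: "'a topology \<Rightarrow> ('a \<Rightarrow> 'k::real_normed_field) set" where
  "cfun X = {f. continuous_map X euclidean f \<and> (\<forall>x. x \<notin> topspace X \<longrightarrow> f x = 0)}"

definition cfun0 :: "'a topology \<Rightarrow> ('a \<Rightarrow> 'k::real_normed_field) set" where
  "cfun0 X = {f \<in> cfun X. \<forall>\<epsilon>>0. \<exists>K. compactin X K \<and> (\<forall>x \<in> topspace X - K. norm (f x) < \<epsilon>)}"

definition zero_set :: "'a topology \<Rightarrow> ('a \<Rightarrow> 'k::real_normed_field) \<Rightarrow> 'a set" where
  "zero_set X f = {x \<in> topspace X. f x = 0}"

text \<open>The first argument selects the scalar field, which the type of the result does not mention.\<close>

definition zero_sets :: "'k::real_normed_field itself \<Rightarrow> 'a topology \<Rightarrow> 'a set set" where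
  "zero_sets _ X = zero_set X ` (cfun X :: ('a \<Rightarrow> 'k) set)"

definition z_filter :: "'k::real_normed_field itself \<Rightarrow> 'a topology \<Rightarrow> 'a set set \<Rightarrow> bool" where
  "z_filter k X \<F> \<longleftrightarrow>
     \<F> \<noteq> {} \<and> \<F> \<subset> zero_sets k X \<and>
     (\<forall>Z1\<in>\<F>. \<forall>Z2\<in>\<F>. Z1 \<inter> Z2 \<in> \<F>) \<and>
     (\<forall>Z1\<in>\<F>. \<forall>Z2\<in>zero_sets k X. Z1 \<subseteq> Z2 \<longrightarrow> Z2 \<in> \<F>)"

definition prime_z_filter :: "'k::real_normed_field itself \<Rightarrow> 'a topology \<Rightarrow> 'a set set \<Rightarrow> bool" where
  "prime_z_filter k X \<P> \<longleftrightarrow>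
     z_filter k X \<P> \<and>
     (\<forall>Z1 \<in> zero_sets k X - \<P>. \<forall>Z2 \<in> zero_sets k X - \<P>. Z1 \<union> Z2 \<notin> \<P>)"

definition zero_set_preimage :: "'a topology \<Rightarrow> 'a set set \<Rightarrow> ('a \<Rightarrow> 'k::real_normed_field) set" where
  "zero_set_preimage X \<F> = {f \<in> cfun X. zero_set X f \<in> \<F>}"

text \<open>
  The algebra \<open>cfun0 X\<close> has no unit unless \<open>X\<close> is compact, so the ideals of HOL-Algebra, which
  live in unital rings, do not apply. Ideals are algebra ideals, i.e. closed under scalar
  multiplication.
\<close>

definition cfun0_ideal :: "'a topology \<Rightarrow> ('a \<Rightarrow> 'k::real_normed_field) set \<Rightarrow> bool" where
  "cfun0_ideal X I \<longleftrightarrow>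
     I \<subseteq> cfun0 X \<and> (\<lambda>x. 0) \<in> I \<and>
     (\<forall>f\<in>I. \<forall>g\<in>I. (\<lambda>x. f x + g x) \<in> I) \<and>
     (\<forall>c. \<forall>f\<in>I. (\<lambda>x. c * f x) \<in> I) \<and>
     (\<forall>f\<in>I. \<forall>g\<in>cfun0 X. (\<lambda>x. g x * f x) \<in> I)"

definition cfun0_prime_ideal :: "'a topology \<Rightarrow> ('a \<Rightarrow> 'k::real_normed_field) set \<Rightarrow> bool" where
  "cfun0_prime_ideal X I \<longleftrightarrow>
     cfun0_ideal X I \<and> I \<noteq> cfun0 X \<and>
     (\<forall>f\<in>cfun0 X. \<forall>g\<in>cfun0 X. (\<lambda>x. f x * g x) \<in> I \<longrightarrow> f \<in> I \<or> g \<in> I)"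

definition cfun0_z_ideal :: "'a topology \<Rightarrow> ('a \<Rightarrow> 'k::real_normed_field) set \<Rightarrow> bool" where
  "cfun0_z_ideal X I \<longleftrightarrow>
     cfun0_ideal X I \<and>
     (\<forall>g\<in>cfun0 X. \<forall>f\<in>I. zero_set X f \<subseteq> zero_set X g \<longrightarrow> g \<in> I)"

text \<open>Ordinals are represented by well-orders \<open>\<kappa>\<close>, in the (reflexive) sense of \<open>Well_order\<close>.\<close>

definition increasing_chain :: "'i rel \<Rightarrow> ('i \<Rightarrow> 'b set) \<Rightarrow> bool" where
  "increasing_chain \<kappa> Q \<longleftrightarrow>
     (\<forall>\<alpha>\<in>Field \<kappa>. \<forall>\<beta>\<in>Field \<kappa>. (\<alpha>, \<beta>) \<in> \<kappa> \<and> \<alpha> \<noteq> \<beta> \<longrightarrow> Q \<alpha> \<subset> Q \<beta>)"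

end

theory Submission
  imports Defs
begin

text \<open>
  In a metrizable space the zero sets are the closed sets. Suppose that there are closed sets
  \<open>Z \<alpha>\<close> (\<open>\<alpha> \<in> Field \<kappa>\<close>) such that, for every finite set \<open>F\<close> of indices and every
  \<open>\<beta> \<notin> F\<close>, each point of \<open>\<Inter>\<alpha>\<in>F. Z \<alpha>\<close> is a limit of points of
  \<open>(\<Inter>\<alpha>\<in>F. Z \<alpha>) - Z \<beta>\<close>. Choosing points from the largest index downwards, each very
  close to its predecessor, one satisfies any finitely many of the conditions
  \<open>p \<alpha> \<notin> Z \<alpha>\<close>, \<open>p \<beta> \<in> Z \<alpha>\<close> and \<open>p \<alpha> \<in> W \<longrightarrow> p \<beta> \<in> W\<close>
  (\<open>\<alpha> < \<beta>\<close>, \<open>W\<close> closed) on a function \<open>p\<close> from indices to points. So some ultrafilter on such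
  functions contains all these conditions, and the closed sets containing \<open>p \<alpha>\<close> for
  almost all \<open>p\<close> form the \<open>\<alpha>\<close>-th prime \<open>z\<close>-filter.

  The sets \<open>Z \<alpha>\<close> come from a tree of points in the perfect kernel, in which the children of each
  node converge to it, and from continuum many almost disjoint sets of natural numbers: a node
  belongs to \<open>Z \<alpha>\<close> if none of its coordinates lies in the \<open>\<alpha>\<close>-th almost disjoint set. If the tree
  lies in a relatively compact open set \<open>V\<close> and every \<open>Z \<alpha>\<close> contains the complement of \<open>V\<close>, then
  \<open>Z \<alpha>\<close> is the zero set of a function with compact support, which separates the ideals.
\<close>

section \<open>Zero sets and the algebra of functions vanishing at infinity\<close>

lemma cfun_mult:
  assumes "f \<in> cfun X" "g \<in> (cfun X :: ('a \<Rightarrow> 'k::real_normed_field) set)"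
  shows "(\<lambda>x. f x * g x) \<in> cfun X"
  using assms by (auto simp: cfun_def continuous_map_atin tendsto_mult)

lemma cfun0_add:
  assumes f: "f \<in> cfun0 X" and g: "g \<in> (cfun0 X :: ('a \<Rightarrow> 'k::real_normed_field) set)"
  shows "(\<lambda>x. f x + g x) \<in> cfun0 X"
proof -
  have "(\<lambda>x. f x + g x) \<in> cfun X"
    using f g by (auto simp: cfun0_def cfun_def continuous_map_add)
  moreover have "\<exists>K. compactin X K \<and> (\<forall>x \<in> topspace X - K. norm (f x + g x) < \<epsilon>)"
    if "\<epsilon> > 0" for \<epsilon> :: real
  proof -
    obtain K L where K: "compactin X K" "\<forall>x \<in> topspace X - K. norm (f x) < \<epsilon>/2"
      and L: "compactin X L" "\<forall>x \<in> topspace X - L. norm (g x) < \<epsilon>/2"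
      using f g half_gt_zero[OF \<open>\<epsilon> > 0\<close>] unfolding cfun0_def by blast
    have "norm (f x + g x) < \<epsilon>" if "x \<in> topspace X - (K \<union> L)" for x
    proof -
      have "norm (f x) < \<epsilon>/2" "norm (g x) < \<epsilon>/2"
        using K(2) L(2) that by auto
      then show ?thesis
        by (intro norm_triangle_lt) linarith
    qed
    then show ?thesis
      using K(1) L(1) compactin_Un by blast
  qed
  ultimately show ?thesis
    by (simp add: cfun0_def)
qed

lemma cfun0_mult:
  assumes f: "f \<in> cfun0 X" and g: "g \<in> (cfun0 X :: ('a \<Rightarrow> 'k::real_normed_field) set)"
  shows "(\<lambda>x. f x * g x) \<in> cfun0 X"
proof -
  have "(\<lambda>x. f x * g x) \<in> cfun X"
    using f g by (auto simp: cfun0_def cfun_mult)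
  moreover have "\<exists>K. compactin X K \<and> (\<forall>x \<in> topspace X - K. norm (f x * g x) < \<epsilon>)"
    if "\<epsilon> > 0" for \<epsilon> :: real
  proof -
    obtain K L where K: "compactin X K" "\<forall>x \<in> topspace X - K. norm (f x) < 1"
      and L: "compactin X L" "\<forall>x \<in> topspace X - L. norm (g x) < \<epsilon>"
      using f g \<open>\<epsilon> > 0\<close> zero_less_one unfolding cfun0_def by blast
    have "norm (f x * g x) < \<epsilon>" if "x \<in> topspace X - (K \<union> L)" for x
      using K(2) L(2) that mult_strict_mono'[of "norm (f x)" 1 "norm (g x)" \<epsilon>]
      by (simp add: norm_mult)
    then show ?thesis
      using K(1) L(1) compactin_Un by blast
  qed
  ultimately show ?thesis
    by (simp add: cfun0_def)
qed

lemma cfun0_scale: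
  assumes f: "f \<in> (cfun0 X :: ('a \<Rightarrow> 'k::real_normed_field) set)"
  shows "(\<lambda>x. c * f x) \<in> cfun0 X"
proof (cases "c = 0")
  case True
  then show ?thesis
    using compactin_empty by (auto simp: cfun0_def cfun_def)
next
  case False
  have "(\<lambda>x. c * f x) \<in> cfun X"
    using f by (auto simp: cfun0_def cfun_def continuous_map_atin tendsto_mult)
  moreover have "\<exists>K. compactin X K \<and> (\<forall>x \<in> topspace X - K. norm (c * f x) < \<epsilon>)"
    if "\<epsilon> > 0" for \<epsilon> :: real
  proof -
    have "\<epsilon> / norm c > 0"
      using False that by simp
    then obtain K where K: "compactin X K" "\<forall>x \<in> topspace X - K. norm (f x) < \<epsilon> / norm c"
      using f unfolding cfun0_def by blast
    then show ?thesis
      using False by (auto simp: norm_mult field_simps)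
  qed
  ultimately show ?thesis
    by (simp add: cfun0_def)
qed

lemma zero_set_mult: "zero_set X (\<lambda>x. f x * g x) = zero_set X f \<union> zero_set X g"
  by (auto simp: zero_set_def)

lemma zero_set_in_zero_sets:
  fixes f :: "'a \<Rightarrow> 'k::real_normed_field"
  shows "f \<in> cfun X \<Longrightarrow> zero_set X f \<in> zero_sets TYPE('k) X"
  by (simp add: zero_sets_def)

lemma closedin_zero_sets:
  assumes "Z \<in> zero_sets TYPE('k::real_normed_field) X"
  shows "closedin X Z"
proof -
  obtain f :: "'a \<Rightarrow> 'k" where f: "continuous_map X euclidean f" "Z = zero_set X f"
    using assms by (auto simp: zero_sets_def cfun_def)
  have "closedin X {x \<in> topspace X. f x \<in> {0}}"
    by (rule closedin_continuous_map_preimage[OF f(1)]) simp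
  then show ?thesis
    using f(2) by (simp add: zero_set_def)
qed

text \<open>The distance \<open>\<delta>\<close> to \<open>C\<close>, carried into the scalars by
  \<open>of_real\<close>, is 1-Lipschitz, and it vanishes only on \<open>C\<close> because
  \<open>C\<close> is closed.\<close>

lemma (in Metric_space) closedin_imp_zero_set:
  assumes "closedin mtopology C"
  shows "\<exists>f \<in> cfun mtopology :: ('a \<Rightarrow> 'k::real_normed_field) set. zero_set mtopology f = C"
proof (cases "C = {}")
  case True
  \<comment> \<open>The distance to the empty set would be an infimum over nothing, so the constant
    1, cut off outside \<open>M\<close>, replaces it.\<close>
  have "(\<lambda>x. if x \<in> M then 1 else 0 :: 'k) \<in> cfun mtopology"
    by (auto simp: cfun_def intro: continuous_map_eq[of _ _ "\<lambda>x. 1"])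
  with True show ?thesis
    by (intro bexI) (auto simp: zero_set_def)
next
  case False
  have CM: "C \<subseteq> M"
    using assms closedin_subset by fastforce
  define \<delta> where "\<delta> x = Inf (d x ` C)" for x
  have bdd: "bdd_below (d x ` C)" for x
    by (rule bdd_belowI[of _ 0]) auto
  have le: "\<delta> x \<le> d x y + \<delta> y" if "x \<in> M" "y \<in> M" for x y
  proof -
    have "\<delta> x - d x y \<le> d y c" if "c \<in> C" for c
    proof -
      have "\<delta> x \<le> d x c"
        unfolding \<delta>_def using that bdd by (intro cInf_lower) auto
      also have "\<dots> \<le> d x y + d y c"
        using \<open>x \<in> M\<close> \<open>y \<in> M\<close> CM that by (intro triangle) auto
      finally show ?thesis by simp
    qed
    then have "\<delta> x - d x y \<le> \<delta> y"
      unfolding \<delta>_def using False by (intro cInf_greatest) auto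
    then show ?thesis by simp
  qed
  define f where "f x = (if x \<in> M then of_real (\<delta> x) else 0 :: 'k)" for x
  have dist_f: "dist (f x) (f y) \<le> d x y" if "x \<in> M" "y \<in> M" for x y
    using le[of x y] le[of y x] that commute[of x y]
    by (simp add: f_def dist_norm abs_le_iff flip: of_real_diff)
  have "openin mtopology {x \<in> M. f x \<in> U}" if "open U" for U
    unfolding openin_mtopology
  proof (intro conjI allI impI)
    fix x assume "x \<in> {x \<in> M. f x \<in> U}"
    then obtain r where "r > 0" "\<forall>z. dist z (f x) < r \<longrightarrow> z \<in> U" "x \<in> M"
      using \<open>open U\<close> by (auto simp: open_dist)
    then have "mball x r \<subseteq> {x \<in> M. f x \<in> U}"
      using dist_f by (auto simp: dist_commute) (metis dist_commute le_less_trans)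
    then show "\<exists>r>0. mball x r \<subseteq> {x \<in> M. f x \<in> U}"
      using \<open>r > 0\<close> by blast
  qed auto
  then have "f \<in> cfun mtopology"
    by (auto simp: cfun_def continuous_map_def f_def)
  moreover have "zero_set mtopology f = C"
  proof
    show "C \<subseteq> zero_set mtopology f"
    proof
      fix x assume "x \<in> C"
      then have "\<delta> x \<le> d x x"
        unfolding \<delta>_def using bdd by (intro cInf_lower) auto
      moreover have "\<delta> x \<ge> 0"
        unfolding \<delta>_def using False by (intro cInf_greatest) auto
      ultimately show "x \<in> zero_set mtopology f"
        using CM \<open>x \<in> C\<close> by (auto simp: zero_set_def f_def)
    qed
    show "zero_set mtopology f \<subseteq> C"
    proof
      fix x assume "x \<in> zero_set mtopology f"
      then have x: "x \<in> M" "\<delta> x = 0"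
        by (auto simp: zero_set_def f_def)
      show "x \<in> C"
      proof (rule ccontr)
        assume "x \<notin> C"
        then obtain r where r: "r > 0" "disjnt C (mball x r)"
          using assms x by (metis closedin_metric DiffI)
        have "r \<le> \<delta> x"
          unfolding \<delta>_def using False r x CM
          by (intro cInf_greatest) (auto simp: disjnt_iff not_less[symmetric])
        with x r show False by simp
      qed
    qed
  qed
  ultimately show ?thesis
    by blast
qed

text \<open>Multiplying by a scalar or a function only enlarges zero sets, the zero set of a sum
  contains the intersection, and that of a product is the union, so each ideal property comes from a
  filter property. The function \<open>f0\<close> witnesses properness.\<close>

lemma prime_z_filter_imp_ideal:
  fixes X :: "'a topology"
  assumes \<P>: "prime_z_filter TYPE('k::real_normed_field) X \<P>"
    and f0: "f0 \<in> (cfun0 X :: ('a \<Rightarrow> 'k) set)" "zero_set X f0 \<notin> \<P>"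
  defines "I \<equiv> cfun0 X \<inter> zero_set_preimage X \<P> :: ('a \<Rightarrow> 'k) set"
  shows "cfun0_prime_ideal X I" "cfun0_z_ideal X I"
proof -
  have sub: "\<P> \<subseteq> zero_sets TYPE('k) X" and ne: "\<P> \<noteq> {}"
    and inter: "\<And>Z W. Z \<in> \<P> \<Longrightarrow> W \<in> \<P> \<Longrightarrow> Z \<inter> W \<in> \<P>"
    and up: "\<And>Z W. Z \<in> \<P> \<Longrightarrow> W \<in> zero_sets TYPE('k) X \<Longrightarrow> Z \<subseteq> W \<Longrightarrow> W \<in> \<P>"
    and prime: "\<And>Z W. Z \<union> W \<in> \<P> \<Longrightarrow> Z \<in> zero_sets TYPE('k) X \<Longrightarrow> W \<in> zero_sets TYPE('k) X
                  \<Longrightarrow> Z \<in> \<P> \<or> W \<in> \<P>"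
    using \<P> unfolding prime_z_filter_def z_filter_def by blast+
  have cfun0_cfun: "f \<in> cfun0 X \<Longrightarrow> f \<in> cfun X" for f :: "'a \<Rightarrow> 'k"
    by (simp add: cfun0_def)
  have memI: "f \<in> I \<longleftrightarrow> f \<in> cfun0 X \<and> zero_set X f \<in> \<P>" for f
    by (auto simp: I_def zero_set_preimage_def cfun0_def)
  have mono: "g \<in> I" if "g \<in> cfun0 X" "f \<in> I" "zero_set X f \<subseteq> zero_set X g" for f g
    using that up zero_set_in_zero_sets cfun0_cfun unfolding memI by blast
  have zero: "(\<lambda>x. 0) \<in> I"
  proof -
    have 0: "(\<lambda>x. 0 :: 'k) \<in> cfun0 X"
      using cfun0_scale[OF f0(1), of 0] by simp
    obtain Z where "Z \<in> \<P>"
      using ne by blast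
    moreover have "Z \<subseteq> topspace X"
      using closedin_zero_sets sub \<open>Z \<in> \<P>\<close> by (meson closedin_subset subsetD)
    ultimately show ?thesis
      using up[of Z "zero_set X (\<lambda>x. 0 :: 'k)"] 0 zero_set_in_zero_sets[OF cfun0_cfun[OF 0]]
      by (auto simp: memI zero_set_def)
  qed
  have add: "(\<lambda>x. f x + g x) \<in> I" if "f \<in> I" "g \<in> I" for f g
  proof -
    have "zero_set X f \<inter> zero_set X g \<in> \<P>" and fg: "(\<lambda>x. f x + g x) \<in> cfun0 X"
      using that inter by (auto simp: memI cfun0_add)
    moreover have "zero_set X f \<inter> zero_set X g \<subseteq> zero_set X (\<lambda>x. f x + g x)"
      by (auto simp: zero_set_def)
    ultimately show ?thesis
      using up zero_set_in_zero_sets[OF cfun0_cfun[OF fg]] by (auto simp: memI)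
  qed
  have "(\<lambda>x. c * f x) \<in> I" if "f \<in> I" for f c
    using that by (intro mono[OF cfun0_scale _, of f f c]) (auto simp: memI zero_set_def)
  moreover have "(\<lambda>x. g x * f x) \<in> I" if "f \<in> I" "g \<in> cfun0 X" for f g
    using that by (intro mono[OF cfun0_mult _ , of g f]) (auto simp: memI zero_set_def)
  ultimately have ideal: "cfun0_ideal X I"
    using zero add by (auto simp: cfun0_ideal_def memI)
  then show "cfun0_z_ideal X I"
    using mono by (auto simp: cfun0_z_ideal_def)
  have "f \<in> I \<or> g \<in> I" if "f \<in> cfun0 X" "g \<in> cfun0 X" "(\<lambda>x. f x * g x) \<in> I" for f g
    using that prime zero_set_in_zero_sets cfun0_cfun unfolding memI zero_set_mult by blast
  moreover have "I \<noteq> cfun0 X"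
    using f0 memI by blast
  ultimately show "cfun0_prime_ideal X I"
    using ideal by (auto simp: cfun0_prime_ideal_def)
qed

section \<open>Ultrafilters\<close>

text \<open>Zorn's lemma yields a minimal proper filter below \<open>F\<close>. A smaller filter has
  more eventual properties, hence the reversed order.\<close>

lemma ultrafilter_exists:
  assumes "F \<noteq> bot"
  shows "\<exists>U \<le> F. U \<noteq> bot \<and> (\<forall>P. eventually P U \<or> eventually (\<lambda>x. \<not> P x) U)"
proof -
  let ?A = "{G. G \<le> F \<and> G \<noteq> bot}"
  have "\<exists>m\<in>?A. \<forall>a\<in>?A. a \<le> m \<longrightarrow> a = m"
  proof (rule predicate_Zorn)
    show "partial_order_on ?A (relation_of (\<lambda>x y. y \<le> x) ?A)"
      by (rule partial_order_on_relation_ofI) auto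
    fix C assume C: "C \<in> Chains (relation_of (\<lambda>x y. y \<le> x) ?A)"
    then have CA: "C \<subseteq> ?A"
      by (rule Chains_relation_of)
    show "\<exists>u\<in>?A. \<forall>a\<in>C. u \<le> a"
    proof (cases "C = {}")
      case True
      with assms show ?thesis by auto
    next
      case False
      \<comment> \<open>A chain is directed, so whatever is eventual for \<open>Inf C\<close> is
        eventual for some member, and \<open>Inf C\<close> inherits properness.\<close>
      have "\<exists>x\<in>C. x \<le> inf G H" if "G \<in> C" "H \<in> C" for G H
      proof -
        have "G \<le> H \<or> H \<le> G"
          using C that unfolding Chains_def relation_of_def by blast
        then show ?thesis
          using that by (metis inf.absorb1 inf.absorb2 order_refl)
      qed
      then have "eventually P (Inf C) \<longleftrightarrow> (\<exists>b\<in>C. eventually P b)" for P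
        using eventually_Inf_base[OF False] by blast
      then have "Inf C \<noteq> bot"
        using CA by (auto simp: trivial_limit_def)
      moreover have "Inf C \<le> F"
        using False CA by (auto intro: Inf_lower2)
      ultimately show ?thesis
        by (auto intro: Inf_lower)
    qed
  qed
  then obtain U where U: "U \<le> F" "U \<noteq> bot" and max: "\<And>G. G \<le> U \<Longrightarrow> G \<noteq> bot \<Longrightarrow> G = U"
    using order_trans by blast
  \<comment> \<open>Either refining \<open>U\<close> by \<open>P\<close> destroys properness, so the
    negation was already eventual, or minimality shows that the refinement is \<open>U\<close>
    itself.\<close>
  have "eventually P U \<or> eventually (\<lambda>x. \<not> P x) U" for P
  proof (cases "inf U (principal {x. P x}) = bot")
    case True
    then show ?thesis
      by (simp add: trivial_limit_def eventually_inf_principal)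
  next
    case False
    then have "U \<le> principal {x. P x}"
      using max by (metis inf.cobounded1 inf.cobounded2)
    then show ?thesis
      by (simp add: le_principal)
  qed
  with U show ?thesis
    by blast
qed

section \<open>Chains of ultrafilter limits of points\<close>

lemma finite_Linear_order_least:
  assumes lin: "Linear_order r" and "finite S" "S \<noteq> {}" "S \<subseteq> Field r"
  shows "\<exists>m\<in>S. \<forall>s\<in>S. (m, s) \<in> r"
  using assms(2-)
proof (induction S rule: finite_ne_induct)
  case (singleton x)
  then show ?case
    using lin by (auto simp: order_on_defs refl_on_def)
next
  case (insert x S)
  then obtain m where m: "m \<in> S" "\<forall>s\<in>S. (m, s) \<in> r"
    by auto
  have "x \<in> Field r" "m \<in> Field r"
    using insert.prems m(1) by auto
  moreover have "refl_on (Field r) r" "total_on (Field r) r"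
    using lin by (auto simp: order_on_defs)
  ultimately have refl: "(x, x) \<in> r" and total: "(x, m) \<in> r \<or> (m, x) \<in> r"
    by (metis refl_onD, metis refl_onD total_on_def)
  show ?case
  proof (cases "(x, m) \<in> r")
    case True
    have "trans r"
      using lin by (auto simp: order_on_defs)
    then have "\<forall>s\<in>S. (x, s) \<in> r"
      using True m(2) by (blast dest: transD)
    with refl show ?thesis by blast
  next
    case False
    with total m show ?thesis by blast
  qed
qed

text \<open>
  Only the points of \<open>E\<close>, later the nodes of a tree, are required to be such limits.
\<close>

locale independent_family =
  fixes X :: "'a topology" and E :: "'a set" and I :: "'i set" and Z :: "'i \<Rightarrow> 'a set"
  assumes E_ne: "\<exists>x\<in>E. \<forall>i\<in>I. x \<in> Z i"
    and E_sub: "E \<subseteq> topspace X"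
    and approx: "\<lbrakk>finite F; F \<subseteq> I; j \<in> I - F; x \<in> E; \<forall>i\<in>F. x \<in> Z i; openin X U; x \<in> U\<rbrakk>
      \<Longrightarrow> \<exists>y \<in> E \<inter> U. (\<forall>i\<in>F. y \<in> Z i) \<and> y \<notin> Z j"
begin

text \<open>Induction on the size of \<open>S\<close>, removing its least index \<open>m\<close>.
  The set \<open>F\<close> makes the induction work: passing \<open>m\<close> to \<open>F\<close>
  for the remaining indices puts all their points into \<open>Z m\<close>, after which the point for
  \<open>m\<close> is chosen near that of the next index.\<close>

lemma finite_approximation:
  assumes lin: "Linear_order r" "Field r = I" and \<W>: "finite \<W>" "\<forall>W\<in>\<W>. closedin X W"
    and "finite S" "S \<subseteq> I" "finite F" "F \<subseteq> I" "F \<inter> S = {}"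
  shows "\<exists>p. (\<forall>\<alpha>\<in>S. p \<alpha> \<in> E - Z \<alpha> \<and> (\<forall>\<gamma>\<in>F. p \<alpha> \<in> Z \<gamma>)) \<and>
             (\<forall>\<alpha>\<in>S. \<forall>\<beta>\<in>S. (\<alpha>, \<beta>) \<in> r \<and> \<alpha> \<noteq> \<beta> \<longrightarrow>
                p \<beta> \<in> Z \<alpha> \<and> (\<forall>W\<in>\<W>. p \<alpha> \<in> W \<longrightarrow> p \<beta> \<in> W))"
  using assms(5-)
proof (induction "card S" arbitrary: S F)
  case 0
  then show ?case by simp
next
  case (Suc n)
  have antisym: "antisym r"
    using lin by (auto simp: order_on_defs)
  have "S \<noteq> {}" "S \<subseteq> Field r"
    using Suc.hyps(2) Suc.prems(2) lin(2) by auto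
  then obtain m where m: "m \<in> S" "\<forall>s\<in>S. (m, s) \<in> r"
    using finite_Linear_order_least[OF lin(1) \<open>finite S\<close>] by blast
  define S' where "S' = S - {m}"
  have S: "S = insert m S'" "m \<notin> S'"
    using m by (auto simp: S'_def)
  have "n = card S'"
    using Suc.hyps(2) Suc.prems(1) m by (simp add: S'_def)
  moreover have "finite S'" "S' \<subseteq> I" "finite (insert m F)" "insert m F \<subseteq> I" "insert m F \<inter> S' = {}"
    using Suc.prems S by auto
  ultimately obtain p
    where p1: "\<forall>\<alpha>\<in>S'. p \<alpha> \<in> E - Z \<alpha> \<and> (\<forall>\<gamma>\<in>insert m F. p \<alpha> \<in> Z \<gamma>)"
      and p2: "\<forall>\<alpha>\<in>S'. \<forall>\<beta>\<in>S'. (\<alpha>, \<beta>) \<in> r \<and> \<alpha> \<noteq> \<beta> \<longrightarrow>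
                p \<beta> \<in> Z \<alpha> \<and> (\<forall>W\<in>\<W>. p \<alpha> \<in> W \<longrightarrow> p \<beta> \<in> W)"
    using Suc.hyps(1)[of S' "insert m F"] by blast
  have mF: "m \<in> I - F"
    using Suc.prems S by auto
  have "\<exists>y \<in> E. (\<forall>i\<in>F. y \<in> Z i) \<and> y \<notin> Z m \<and> (\<forall>W\<in>\<W>. \<forall>\<beta>\<in>S'. y \<in> W \<longrightarrow> p \<beta> \<in> W)"
  proof (cases "S' = {}")
    \<comment> \<open>No later point constrains \<open>y\<close>, so a point of \<open>E\<close>
      common to the \<open>Z i\<close> is the start, with the whole space as neighbourhood.\<close>
    case True
    obtain x where "x \<in> E" "\<forall>i\<in>F. x \<in> Z i"
      using E_ne \<open>F \<subseteq> I\<close> by blast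
    then show ?thesis
      using approx[OF \<open>finite F\<close> \<open>F \<subseteq> I\<close> mF _ _ openin_topspace] E_sub True by blast
  next
    case False
    obtain m' where m': "m' \<in> S'" "\<forall>s\<in>S'. (m', s) \<in> r"
      using finite_Linear_order_least[OF lin(1) \<open>finite S'\<close> False] \<open>S' \<subseteq> I\<close> lin(2) by auto
    \<comment> \<open>Removing the finitely many closed sets that miss \<open>p m'\<close> leaves an
      open set. Then \<open>y \<in> W\<close> gives \<open>p m' \<in> W\<close>, and
      \<open>p2\<close> passes this on from the least index \<open>m'\<close> to the rest of
      \<open>S'\<close>.\<close>
    define U where "U = topspace X - \<Union>{W \<in> \<W>. p m' \<notin> W}"
    have "openin X U"
      unfolding U_def using \<W> by (intro openin_diff closedin_Union) auto
    moreover have "p m' \<in> E" "\<forall>i\<in>F. p m' \<in> Z i"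
      using p1 m'(1) by auto
    moreover have "p m' \<in> U"
      using calculation E_sub by (auto simp: U_def)
    ultimately obtain y where y: "y \<in> E \<inter> U" "\<forall>i\<in>F. y \<in> Z i" "y \<notin> Z m"
      using approx[OF \<open>finite F\<close> \<open>F \<subseteq> I\<close> mF] by meson
    have "p \<beta> \<in> W" if "W \<in> \<W>" "\<beta> \<in> S'" "y \<in> W" for W \<beta>
    proof -
      have "p m' \<in> W"
        using y(1) that by (auto simp: U_def)
      then show ?thesis
        using p2 m' that by metis
    qed
    with y show ?thesis by blast
  qed
  then obtain y where y: "y \<in> E" "\<forall>i\<in>F. y \<in> Z i" "y \<notin> Z m"
    "\<forall>W\<in>\<W>. \<forall>\<beta>\<in>S'. y \<in> W \<longrightarrow> p \<beta> \<in> W"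
    by blast
  \<comment> \<open>By antisymmetry \<open>m\<close> is never the larger index of a pair, so the new
    point has no conditions to meet from below.\<close>
  have "(\<alpha>, m) \<notin> r" if "\<alpha> \<in> S'" for \<alpha>
    using that S m(2) antisym by (metis antisymD insertCI)
  moreover have "\<alpha> \<noteq> m" if "\<alpha> \<in> S'" for \<alpha>
    using that S by auto
  ultimately show ?case
    using y p1 p2 unfolding S(1) by (intro exI[of _ "p(m := y)"]) auto
qed

text \<open>A compactness argument: each \<open>G S \<W>\<close> collects finitely many conditions,
  \<open>finite_approximation\<close> makes it non-empty, and unions of the index data make these
  sets a filter base, which an ultrafilter refines. The last clause later yields the inclusion of
  the \<open>\<alpha>\<close>-th filter in the \<open>\<beta>\<close>-th.\<close>

lemma limit_ultrafilter_exists: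
  assumes lin: "Linear_order r" "Field r = I"
  shows "\<exists>U :: ('i \<Rightarrow> 'a) filter. U \<noteq> bot \<and>
    (\<forall>P. eventually P U \<or> eventually (\<lambda>p. \<not> P p) U) \<and>
    (\<forall>\<alpha>\<in>I. eventually (\<lambda>p. p \<alpha> \<in> E - Z \<alpha>) U) \<and>
    (\<forall>\<alpha>\<in>I. \<forall>\<beta>\<in>I. (\<alpha>, \<beta>) \<in> r \<and> \<alpha> \<noteq> \<beta> \<longrightarrow>
       eventually (\<lambda>p. p \<beta> \<in> Z \<alpha>) U \<and>
       (\<forall>W. closedin X W \<longrightarrow> eventually (\<lambda>p. p \<alpha> \<in> W \<longrightarrow> p \<beta> \<in> W) U))"
proof -
  define G where "G S \<W> = {p. (\<forall>\<alpha>\<in>S. p \<alpha> \<in> E - Z \<alpha>) \<and>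
      (\<forall>\<alpha>\<in>S. \<forall>\<beta>\<in>S. (\<alpha>, \<beta>) \<in> r \<and> \<alpha> \<noteq> \<beta> \<longrightarrow>
                p \<beta> \<in> Z \<alpha> \<and> (\<forall>W\<in>\<W>. p \<alpha> \<in> W \<longrightarrow> p \<beta> \<in> W))}" for S :: "'i set" and \<W>
  define A where "A = {(S, \<W>). finite S \<and> S \<subseteq> I \<and> finite \<W> \<and> (\<forall>W\<in>\<W>. closedin X W)}"
  define F where "F = (INF (S, \<W>)\<in>A. principal (G S \<W>))"
  have ev: "eventually P F \<longleftrightarrow> (\<exists>a\<in>A. eventually P (principal (G (fst a) (snd a))))" for P
    unfolding F_def case_prod_unfold
  proof (rule eventually_INF_base)
    have "({}, {}) \<in> A"
      by (simp add: A_def)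
    then show "A \<noteq> {}" by blast
    fix a b assume "a \<in> A" "b \<in> A"
    then have "(fst a \<union> fst b, snd a \<union> snd b) \<in> A"
      by (auto simp: A_def)
    moreover have "G (fst a \<union> fst b) (snd a \<union> snd b) \<subseteq> G (fst a) (snd a) \<inter> G (fst b) (snd b)"
      unfolding G_def by blast
    ultimately show "\<exists>x\<in>A. principal (G (fst x) (snd x))
        \<le> inf (principal (G (fst a) (snd a))) (principal (G (fst b) (snd b)))"
      by (intro bexI) auto
  qed
  have "G S \<W> \<noteq> {}" if "(S, \<W>) \<in> A" for S \<W>
    using finite_approximation[OF lin, of \<W> S "{}"] that unfolding A_def G_def by auto
  then have "F \<noteq> bot"
    unfolding trivial_limit_def ev by (auto simp: eventually_principal)
  then obtain U where U: "U \<le> F" "U \<noteq> bot" "\<forall>P. eventually P U \<or> eventually (\<lambda>p. \<not> P p) U"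
    using ultrafilter_exists by blast
  have ev_U: "eventually P U" if "(S, \<W>) \<in> A" "\<And>p. p \<in> G S \<W> \<Longrightarrow> P p" for P S \<W>
  proof -
    have "eventually P F"
      unfolding ev using that by (intro bexI[of _ "(S, \<W>)"]) (auto simp: eventually_principal)
    then show ?thesis
      using U(1) by (rule filter_leD[rotated])
  qed
  \<comment> \<open>Each required property involves at most two indices and one closed set, so a
    single base set decides it.\<close>
  have "eventually (\<lambda>p. p \<alpha> \<in> E - Z \<alpha>) U" if "\<alpha> \<in> I" for \<alpha>
    by (rule ev_U[of "{\<alpha>}" "{}"]) (use that in \<open>auto simp: A_def G_def\<close>)
  moreover have "eventually (\<lambda>p. p \<beta> \<in> Z \<alpha>) U"
    if "\<alpha> \<in> I" "\<beta> \<in> I" "(\<alpha>, \<beta>) \<in> r" "\<alpha> \<noteq> \<beta>" for \<alpha> \<beta>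
    by (rule ev_U[of "{\<alpha>, \<beta>}" "{}"]) (use that in \<open>auto simp: A_def G_def\<close>)
  moreover have "eventually (\<lambda>p. p \<alpha> \<in> W \<longrightarrow> p \<beta> \<in> W) U"
    if "\<alpha> \<in> I" "\<beta> \<in> I" "(\<alpha>, \<beta>) \<in> r" "\<alpha> \<noteq> \<beta>" "closedin X W" for \<alpha> \<beta> W
    by (rule ev_U[of "{\<alpha>, \<beta>}" "{W}"]) (use that in \<open>auto simp: A_def G_def\<close>)
  ultimately show ?thesis
    using U(2,3) by blast
qed

end

text \<open>Pushing an ultrafilter forward along \<open>x\<close> and keeping only the closed sets
  turns its either-or property into primality. The set \<open>Z\<close> keeps the result a proper
  subset of the zero sets.\<close>

lemma prime_z_filter_ultrafilter_limit:
  fixes X :: "'a topology" and U :: "'b filter" and x :: "'b \<Rightarrow> 'a"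
  assumes zs: "zero_sets TYPE('k::real_normed_field) X = {Z. closedin X Z}"
    and "U \<noteq> bot" and ultra: "\<And>P. eventually P U \<or> eventually (\<lambda>p. \<not> P p) U"
    and x: "eventually (\<lambda>p. x p \<in> topspace X) U"
    and Z: "closedin X Z" "eventually (\<lambda>p. x p \<notin> Z) U"
  shows "prime_z_filter TYPE('k) X {Z. closedin X Z \<and> eventually (\<lambda>p. x p \<in> Z) U}" (is "prime_z_filter _ X ?P")
proof -
  have contra: False if "eventually P U" "eventually (\<lambda>p. \<not> P p) U" for P
    using eventually_conj[OF that] \<open>U \<noteq> bot\<close> by (simp add: trivial_limit_def)
  have "topspace X \<in> ?P" "Z \<notin> ?P"
    using x Z contra by auto
  then have "?P \<noteq> {}" "?P \<subset> {Z. closedin X Z}"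
    using Z by blast+
  moreover have "Z1 \<inter> Z2 \<in> ?P" if "Z1 \<in> ?P" "Z2 \<in> ?P" for Z1 Z2
    using that by (auto intro: eventually_conj)
  moreover have "Z2 \<in> ?P" if "Z1 \<in> ?P" "closedin X Z2" "Z1 \<subseteq> Z2" for Z1 Z2
    using that by (auto elim!: eventually_mono)
  ultimately have "z_filter TYPE('k) X ?P"
    unfolding z_filter_def zs by blast
  moreover have "Z1 \<in> ?P \<or> Z2 \<in> ?P"
    if cl: "closedin X Z1" "closedin X Z2" and Un: "Z1 \<union> Z2 \<in> ?P" for Z1 Z2
  proof (rule ccontr)
    assume "\<not> (Z1 \<in> ?P \<or> Z2 \<in> ?P)"
    then have "eventually (\<lambda>p. x p \<notin> Z1) U" "eventually (\<lambda>p. x p \<notin> Z2) U"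
      using cl ultra by blast+
    then have "eventually (\<lambda>p. x p \<notin> Z1 \<union> Z2) U"
      by eventually_elim auto
    with Un show False
      using contra by blast
  qed
  ultimately show ?thesis
    unfolding prime_z_filter_def zs by blast
qed

section \<open>Trees of points in crowded sets\<close>

text \<open>\<open>P\<close> consists of the condensation points. Its complement is covered by the
  countable members of a countable base, hence countable; a neighbourhood meeting \<open>P\<close>
  in \<open>x\<close> alone would then be countable too.\<close>

lemma (in Metric_space) ex_condensation_points:
  assumes "separable_space mtopology" "uncountable M"
  obtains P where "P \<subseteq> M" "P \<noteq> {}"
    "\<And>x U. x \<in> P \<Longrightarrow> openin mtopology U \<Longrightarrow> x \<in> U \<Longrightarrow> \<exists>y \<in> P \<inter> U. y \<noteq> x"
proof -
  obtain D where D: "countable D" "D \<subseteq> M" "mtopology closure_of D = M"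
    using assms(1) by (auto simp: separable_space_def)
  define \<B> where "\<B> = (\<lambda>(q, n). mball q (1 / real (Suc n))) ` (D \<times> (UNIV :: nat set))"
  have "countable \<B>"
    using D(1) by (simp add: \<B>_def)
  have basis: "\<exists>V\<in>\<B>. x \<in> V \<and> V \<subseteq> U" if U: "openin mtopology U" "x \<in> U" for x U
  proof -
    obtain r where "r > 0" and r: "mball x r \<subseteq> U" and "x \<in> M"
      using U unfolding openin_mtopology by blast
    \<comment> \<open>Half of \<open>r\<close>, because two radii add up: from \<open>x\<close> to
      \<open>q\<close> and from \<open>q\<close> to \<open>z\<close>.\<close>
    obtain n where n: "1 / real (Suc n) < r / 2"
      using \<open>r > 0\<close> nat_approx_posE half_gt_zero by metis
    have "x \<in> mtopology closure_of D"
      using D(3) \<open>x \<in> M\<close> by simp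
    then obtain q where q: "q \<in> D" "q \<in> mball x (1 / real (Suc n))"
      by (metis \<open>x \<in> M\<close> centre_in_mball_iff in_closure_of of_nat_0_less_iff openin_mball zero_less_Suc zero_less_divide_1_iff)
    have "mball q (1 / real (Suc n)) \<subseteq> mball x r"
    proof
      fix z assume "z \<in> mball q (1 / real (Suc n))"
      then show "z \<in> mball x r"
        using q(2) n triangle[of x q z] by auto
    qed
    moreover have "x \<in> mball q (1 / real (Suc n))"
      using q(2) by (auto simp: commute)
    ultimately show ?thesis
      using r q(1) by (intro bexI[of _ "mball q (1 / real (Suc n))"]) (auto simp: \<B>_def)
  qed
  define P where "P = {x \<in> M. \<forall>U. openin mtopology U \<and> x \<in> U \<longrightarrow> uncountable U}"
  have "M - P \<subseteq> (\<Union>V\<in>{V \<in> \<B>. countable V}. V)"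
  proof
    fix x assume "x \<in> M - P"
    then obtain U where "openin mtopology U" "x \<in> U" "countable U"
      by (auto simp: P_def)
    then obtain V where V: "V \<in> \<B>" "x \<in> V" "V \<subseteq> U"
      using basis by blast
    then have "countable V"
      using countable_subset \<open>countable U\<close> by metis
    with V show "x \<in> (\<Union>V\<in>{V \<in> \<B>. countable V}. V)"
      by blast
  qed
  moreover have "countable {V \<in> \<B>. countable V}"
    by (rule countable_subset[OF _ \<open>countable \<B>\<close>]) blast
  then have "countable (\<Union>V\<in>{V \<in> \<B>. countable V}. V)"
    by (rule countable_UN) simp
  ultimately have countable: "countable (M - P)"
    by (rule countable_subset)
  have "P \<noteq> {}"
    using countable assms(2) by auto
  moreover have "P \<subseteq> M"
    by (auto simp: P_def)
  moreover have "\<exists>y \<in> P \<inter> U. y \<noteq> x" if "x \<in> P" "openin mtopology U" "x \<in> U" for x U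
  proof (rule ccontr)
    assume "\<not> (\<exists>y \<in> P \<inter> U. y \<noteq> x)"
    moreover have "U \<subseteq> M"
      using that(2) openin_subset by fastforce
    ultimately have "U \<subseteq> insert x (M - P)"
      by auto
    then have "countable U"
      by (rule countable_subset) (simp add: countable)
    with that show False
      by (auto simp: P_def)
  qed
  ultimately show thesis
    using that by metis
qed

text \<open>Distances to \<open>x\<close> that more than halve at each step leave room for pairwise
  disjoint annuli centred at \<open>x\<close>, one through each point.\<close>

lemma (in Metric_space) ex_separated_sequence:
  assumes "\<And>V. openin mtopology V \<Longrightarrow> x \<in> V \<Longrightarrow> \<exists>y \<in> P \<inter> V. y \<noteq> x"
    and U: "openin mtopology U" "x \<in> U"
  shows "\<exists>y W. (\<forall>n::nat. y n \<in> P \<inter> W n \<and> openin mtopology (W n) \<and> W n \<subseteq> U - {x}) \<and>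
     (\<forall>m n. m \<noteq> n \<longrightarrow> W m \<inter> W n = {}) \<and> limitin mtopology y x sequentially"
proof -
  have "x \<in> M"
    using U openin_subset by fastforce
  have near: "\<exists>y. y \<in> P \<inter> U \<and> y \<noteq> x \<and> d x y < r" if "r > 0" for r
    using assms(1)[of "U \<inter> mball x r"] openin_Int[OF U(1) openin_mball] U \<open>x \<in> M\<close> that by auto
  \<comment> \<open>The bound by \<open>inverse (real (Suc n))\<close> forces convergence; the
    halving separates the annuli.\<close>
  have "\<exists>y. \<forall>n. (y n \<in> P \<inter> U \<and> y n \<noteq> x \<and> d x (y n) < inverse (real (Suc n))) \<and>
                2 * d x (y (Suc n)) < d x (y n)"
  proof (rule dependent_nat_choice)
    show "\<exists>y. y \<in> P \<inter> U \<and> y \<noteq> x \<and> d x y < inverse (real (Suc 0))"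
      using near[of 1] by simp
    fix z n assume "z \<in> P \<inter> U \<and> z \<noteq> x \<and> d x z < inverse (real (Suc n))"
    then have "d x z > 0"
      using \<open>x \<in> M\<close> U openin_subset by fastforce
    then show "\<exists>y. (y \<in> P \<inter> U \<and> y \<noteq> x \<and> d x y < inverse (real (Suc (Suc n)))) \<and> 2 * d x y < d x z"
      using near[of "min (inverse (real (Suc (Suc n)))) (d x z / 2)"] by auto
  qed
  then obtain y where y: "\<And>n. y n \<in> P" "\<And>n. y n \<in> U" "\<And>n. y n \<noteq> x"
      "\<And>n. d x (y n) < inverse (real (Suc n))"
    and half: "\<And>n. 2 * d x (y (Suc n)) < d x (y n)"
    by blast
  have yM: "y n \<in> M" for n
    using U openin_subset y(2) by fastforce
  then have pos: "d x (y n) > 0" for n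
    using y(3) \<open>x \<in> M\<close> by (metis mdist_pos_less)
  have antimono: "d x (y n) \<le> d x (y m)" if "m \<le> n" for m n
    using that
  proof (induction rule: dec_induct)
    case (step n)
    then show ?case
      using half[of n] pos[of "Suc n"] by linarith
  qed simp
  \<comment> \<open>For \<open>m < n\<close> the outer radius \<open>3/2 * d x (y n)\<close> is
    below the inner radius \<open>3/4 * d x (y m)\<close>, since
    \<open>2 * d x (y n) < d x (y m)\<close>.\<close>
  define W where "W n = {z \<in> U. 3/4 * d x (y n) < d x z \<and> d x z < 3/2 * d x (y n)}" for n
  have W_eq: "W n = U \<inter> mball x (3/2 * d x (y n)) - mcball x (3/4 * d x (y n))" for n
    using U openin_subset[of mtopology U] \<open>x \<in> M\<close> by (auto simp: W_def not_le)
  have "W m \<inter> W n = {}" if "m < n" for m n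
  proof -
    have "2 * d x (y n) < d x (y m)"
      using antimono[of "Suc m" n] half[of m] that by simp
    then show ?thesis
      by (auto simp: W_def)
  qed
  then have "W m \<inter> W n = {}" if "m \<noteq> n" for m n
    using that by (metis Int_commute linorder_neqE_nat)
  moreover have "openin mtopology (W n)" for n
    unfolding W_eq using U by (intro openin_diff openin_Int) auto
  moreover have "y n \<in> P \<inter> W n" "x \<notin> W n" "W n \<subseteq> U" for n
    using y pos[of n] \<open>x \<in> M\<close> by (auto simp: W_def)
  moreover have "limitin mtopology y x sequentially"
    unfolding limitin_metric_dist_null
  proof (intro conjI)
    show "(\<lambda>n. d (y n) x) \<longlonglongrightarrow> 0"
      using y(4) by (intro tendsto_sandwich[OF _ _ tendsto_const LIMSEQ_inverse_real_of_nat])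
        (auto simp: commute intro!: always_eventually less_imp_le)
  qed (use \<open>x \<in> M\<close> yM in auto)
  ultimately show ?thesis
    by (intro exI[of _ y] exI[of _ W]) blast
qed

text \<open>A list names a node with its latest branching first, so \<open>n # l\<close> is the
  \<open>n\<close>-th child of \<open>l\<close>. The open set \<open>B l\<close> is reserved for the
  subtree at \<open>l\<close>.\<close>

lemma (in Metric_space) ex_tree:
  assumes "\<And>x V. x \<in> P \<Longrightarrow> openin mtopology V \<Longrightarrow> x \<in> V \<Longrightarrow> \<exists>y \<in> P \<inter> V. y \<noteq> x"
    and "x0 \<in> P" and V: "openin mtopology V" "x0 \<in> V"
  obtains e :: "nat list \<Rightarrow> 'a" and B where
    "B [] = V"
    "\<And>l. e l \<in> B l" "\<And>l. openin mtopology (B l)"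
    "\<And>n l. B (n # l) \<subseteq> B l - {e l}"
    "\<And>m n l. m \<noteq> n \<Longrightarrow> B (m # l) \<inter> B (n # l) = {}"
    "\<And>l. limitin mtopology (\<lambda>n. e (n # l)) (e l) sequentially"
proof -
  define S where "S x U y W \<longleftrightarrow>
     (\<forall>n::nat. y n \<in> P \<inter> W n \<and> openin mtopology (W n) \<and> W n \<subseteq> U - {x}) \<and>
     (\<forall>m n. m \<noteq> n \<longrightarrow> W m \<inter> W n = {}) \<and> limitin mtopology y x sequentially" for x U y W
  have "\<exists>y W. S x U y W" if "x \<in> P" "openin mtopology U" "x \<in> U" for x U
    unfolding S_def using ex_separated_sequence[OF assms(1) that(2,3)] that(1) .
  then obtain y W where step: "\<And>x U. x \<in> P \<Longrightarrow> openin mtopology U \<Longrightarrow> x \<in> U \<Longrightarrow> S x U (y x U) (W x U)"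
    by metis
  \<comment> \<open>Point and reserved set come from one recursion, because the choice of the
    children depends on both.\<close>
  define node where "node = rec_list (x0, V) (\<lambda>n l (x, U). (y x U n, W x U n))"
  define e where "e l = fst (node l)" for l
  define B where "B l = snd (node l)" for l
  have root: "e [] = x0" "B [] = V"
    and child: "e (n # l) = y (e l) (B l) n" "B (n # l) = W (e l) (B l) n" for n l
    by (simp_all add: e_def B_def node_def case_prod_unfold)
  have inv: "e l \<in> P \<and> e l \<in> B l \<and> openin mtopology (B l)" for l
  proof (induction l)
    case Nil
    then show ?case
      using assms by (simp add: root)
  next
    case (Cons n l)
    then show ?case
      using step[of "e l" "B l"] unfolding S_def by (simp add: child)
  qed
  have step': "(\<forall>n. B (n # l) \<subseteq> B l - {e l}) \<and> (\<forall>m n. m \<noteq> n \<longrightarrow> B (m # l) \<inter> B (n # l) = {}) \<and>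
     limitin mtopology (\<lambda>n. e (n # l)) (e l) sequentially" for l
    using step[of "e l" "B l"] inv[of l] unfolding S_def child by auto
  show thesis
    by (rule that[of B e]) (use root inv step' in blast)+
qed

text \<open>Induction on \<open>l\<close>: a node in \<open>B (n # l)\<close> lies in
  \<open>B l\<close>, so it descends from \<open>l\<close>; it is not \<open>l\<close>, as
  \<open>e l\<close> was removed; and disjointness of the siblings' sets forces its path through the
  \<open>n\<close>-th child.\<close>

lemma tree_node_in_nbhd_imp_suffix:
  assumes eB: "\<And>l. e l \<in> B l"
    and sub: "\<And>n l. B (n # l) \<subseteq> B l - {e l}"
    and disj: "\<And>m n l. m \<noteq> n \<Longrightarrow> B (m # l) \<inter> B (n # l) = {}"
    and "e k \<in> B l"
  shows "\<exists>k'. k = k' @ l"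
  using assms(4)
proof (induction l)
  case (Cons n l)
  have mono: "B (k @ l) \<subseteq> B l" for k l
    by (induction k) (use sub in auto)
  have "e k \<in> B l"
    using Cons.prems sub by blast
  then obtain k' where k': "k = k' @ l"
    using Cons.IH by blast
  have "k' \<noteq> []"
    using k' Cons.prems sub[of n l] by auto
  then obtain k'' m where k'': "k' = k'' @ [m]"
    by (metis rev_exhaust)
  have "e k \<in> B (m # l)"
    using eB[of k] mono[of k'' "m # l"] k' k'' by auto
  then have "m = n"
    using Cons.prems disj by blast
  with k' k'' show ?case
    by auto
qed simp

section \<open>Independent closed sets from almost disjoint sets\<close>

text \<open>The code \<open>a s n\<close> records \<open>n\<close> and the part of \<open>s\<close>
  below \<open>n\<close>, so \<open>range (a s)\<close> is a branch of the binary tree. Distinct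
  branches share only finitely many codes, so finitely many of them cannot exhaust another.\<close>

lemma almost_disjoint_family:
  obtains A :: "nat set \<Rightarrow> nat set" where
    "\<And>F s. finite F \<Longrightarrow> s \<notin> F \<Longrightarrow> infinite (A s - (\<Union>r\<in>F. A r))"
proof
  define a where "a s n = prod_encode (n, set_encode (s \<inter> {..<n}))" for s :: "nat set" and n
  fix F and s :: "nat set" assume F: "finite F" "s \<notin> F"
  have "\<exists>N. \<forall>n\<ge>N. a s n \<notin> range (a r)" if neq: "r \<noteq> s" for r
  proof -
    obtain N where N: "N \<in> r \<longleftrightarrow> N \<notin> s"
      using neq by blast
    \<comment> \<open>\<open>Suc N\<close> puts \<open>N\<close> into \<open>{..<n}\<close>, where
      the two sets differ.\<close>
    have "a s n \<noteq> a r m" if "n \<ge> Suc N" for n m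
    proof
      assume "a s n = a r m"
      then have "s \<inter> {..<n} = r \<inter> {..<n}"
        by (auto simp: a_def prod_encode_eq set_encode_eq)
      with N that show False
        by (metis Int_iff Suc_le_eq lessThan_iff)
    qed
    then show ?thesis by blast
  qed
  then obtain N where N: "\<And>r n. r \<noteq> s \<Longrightarrow> n \<ge> N r \<Longrightarrow> a s n \<notin> range (a r)"
    by metis
  \<comment> \<open>The inserted 0 covers an empty \<open>F\<close>.\<close>
  define n0 where "n0 = Max (insert 0 (N ` F))"
  have "a s n \<notin> range (a r)" if "n0 \<le> n" "r \<in> F" for n r
  proof -
    have "N r \<le> n0"
      unfolding n0_def using F(1) \<open>r \<in> F\<close> by (intro Max_ge) auto
    moreover have "r \<noteq> s"
      using F(2) \<open>r \<in> F\<close> by blast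
    ultimately show ?thesis
      using N \<open>n0 \<le> n\<close> by simp
  qed
  then have "a s ` {n0..} \<subseteq> range (a s) - (\<Union>r\<in>F. range (a r))"
    by auto
  moreover have "inj_on (a s) {n0..}"
    by (auto simp: inj_on_def a_def prod_encode_eq)
  then have "infinite (a s ` {n0..})"
    by (simp add: finite_image_iff infinite_Ici)
  ultimately show "infinite (range (a s) - (\<Union>r\<in>F. range (a r)))"
    by (rule infinite_super)
qed

text \<open>Local compactness places the tree in an open \<open>V\<close> inside a compact
  \<open>K\<close>; the embedding of \<open>I\<close> into the sets of naturals gives each index its
  own almost disjoint set.\<close>

lemma (in Metric_space) ex_independent_family:
  assumes "separable_space mtopology" "locally_compact_space mtopology" "uncountable M"
    and "I \<lesssim> (UNIV :: nat set set)"
  obtains E V K and Z :: "'i \<Rightarrow> 'a set" where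
    "independent_family mtopology E I Z" "compactin mtopology K" "openin mtopology V" "V \<subseteq> K"
    "E \<subseteq> V" "\<And>i. closedin mtopology (Z i)" "\<And>i. M - V \<subseteq> Z i"
proof -
  obtain P where P: "P \<subseteq> M" "P \<noteq> {}"
    "\<And>x U. x \<in> P \<Longrightarrow> openin mtopology U \<Longrightarrow> x \<in> U \<Longrightarrow> \<exists>y \<in> P \<inter> U. y \<noteq> x"
    using ex_condensation_points[OF assms(1,3)] by blast
  then obtain x0 where "x0 \<in> P" "x0 \<in> M" by blast
  then obtain V K where VK: "openin mtopology V" "compactin mtopology K" "x0 \<in> V" "V \<subseteq> K"
    using assms(2) unfolding locally_compact_space_def by fastforce
  obtain e :: "nat list \<Rightarrow> 'a" and B where Nil: "B [] = V"
    and eB: "\<And>l. e l \<in> B l" and openB: "\<And>l. openin mtopology (B l)"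
    and sub: "\<And>n l. B (n # l) \<subseteq> B l - {e l}"
    and disj: "\<And>m n l. m \<noteq> n \<Longrightarrow> B (m # l) \<inter> B (n # l) = {}"
    and lim: "\<And>l. limitin mtopology (\<lambda>n. e (n # l)) (e l) sequentially"
    using ex_tree[OF P(3) \<open>x0 \<in> P\<close> VK(1,3)] by blast
  have BV: "B l \<subseteq> V" for l
    by (induction l) (use sub Nil in auto)
  obtain A :: "nat set \<Rightarrow> nat set"
    where A: "\<And>F s. finite F \<Longrightarrow> s \<notin> F \<Longrightarrow> infinite (A s - (\<Union>r\<in>F. A r))"
    using almost_disjoint_family by blast
  obtain \<phi> :: "'i \<Rightarrow> nat set" where \<phi>: "inj_on \<phi> I"
    using assms(4) by (auto simp: lepoll_def)
  define Z where "Z i = (M - V) \<union> mtopology closure_of (e ` {l. set l \<inter> A (\<phi> i) = {}})" for i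
  have VM: "V \<subseteq> M"
    using VK(1) openin_subset by fastforce
  have eZ: "e l \<in> Z i \<longleftrightarrow> set l \<inter> A (\<phi> i) = {}" for l i
  proof
    assume "set l \<inter> A (\<phi> i) = {}"
    moreover have "e ` {l. set l \<inter> A (\<phi> i) = {}} \<subseteq> M"
      using eB BV VM by blast
    ultimately show "e l \<in> Z i"
      using closure_of_subset[of "e ` {l. set l \<inter> A (\<phi> i) = {}}" mtopology] by (auto simp: Z_def)
  next
    assume "e l \<in> Z i"
    then have "e l \<in> mtopology closure_of (e ` {l. set l \<inter> A (\<phi> i) = {}})"
      using eB BV by (auto simp: Z_def)
    \<comment> \<open>The closure adds no nodes: every node \<open>k\<close> in the neighbourhood
      \<open>B l\<close> of \<open>e l\<close> has \<open>l\<close> as a suffix, so if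
      \<open>k\<close> avoids \<open>A (\<phi> i)\<close>, so does \<open>l\<close>.\<close>
    then obtain k where "set k \<inter> A (\<phi> i) = {}" "e k \<in> B l"
      using openB eB unfolding in_closure_of by blast
    then show "set l \<inter> A (\<phi> i) = {}"
      using tree_node_in_nbhd_imp_suffix[of e B k l, OF eB sub disj] by auto
  qed
  have indep: "independent_family mtopology (range e) I Z"
  proof
    \<comment> \<open>The root has no coordinates and so belongs to every
      \<open>Z i\<close>.\<close>
    show "\<exists>x\<in>range e. \<forall>i\<in>I. x \<in> Z i"
      using eZ[of "[]"] by auto
    show "range e \<subseteq> topspace mtopology"
      using eB BV VM by fastforce
    fix F j x U
    assume F: "finite F" "F \<subseteq> I" "j \<in> I - F" and x: "x \<in> range e" "\<forall>i\<in>F. x \<in> Z i"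
      and U: "openin mtopology U" "x \<in> U"
    obtain l where l: "x = e l"
      using x by blast
    have "\<phi> j \<notin> \<phi> ` F"
      using F \<phi> by (metis DiffE inj_on_image_mem_iff)
    then have inf: "infinite (A (\<phi> j) - (\<Union>i\<in>F. A (\<phi> i)))"
      using A[of "\<phi> ` F" "\<phi> j"] F(1) by simp
    obtain N where N: "\<And>n. n \<ge> N \<Longrightarrow> e (n # l) \<in> U"
      using limitinD[OF lim[of l] U(1)] U(2) l by (auto simp: eventually_sequentially)
    \<comment> \<open>This one extra coordinate takes the child out of \<open>Z j\<close> while
      keeping it in each \<open>Z i\<close> with \<open>i \<in> F\<close>; \<open>n \<ge> N\<close>
      keeps it in \<open>U\<close>.\<close>
    obtain n where n: "n \<ge> N" "n \<in> A (\<phi> j) - (\<Union>i\<in>F. A (\<phi> i))"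
      using inf by (meson infinite_nat_iff_unbounded_le)
    then show "\<exists>y \<in> range e \<inter> U. (\<forall>i\<in>F. y \<in> Z i) \<and> y \<notin> Z j"
      using N x(2) l eZ by (intro bexI[of _ "e (n # l)"]) auto
  qed
  show thesis
  proof (rule that[OF indep VK(2,1,4)])
    show "range e \<subseteq> V"
      using eB BV by blast
    show "closedin mtopology (Z i)" for i
      unfolding Z_def using VK(1) by (intro closedin_Un closedin_closure_of) (metis closedin_diff closedin_topspace topspace_mtopology)
    show "M - V \<subseteq> Z i" for i
      unfolding Z_def by (rule Un_upper1)
  qed
qed

section \<open>The chains of prime z-filters and of prime z-ideals\<close>

theorem theorem5p7:
  fixes X :: "'a topology" and \<kappa> :: "'i rel"
  assumes "polish_topology X" and "locally_compact_space X" and "uncountable (topspace X)"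
    and "Well_order \<kappa>" and "Field \<kappa> \<approx> (UNIV :: nat set set)"
  shows "\<exists>\<Q> :: 'i \<Rightarrow> 'a set set.
           (\<forall>\<alpha>\<in>Field \<kappa>. prime_z_filter TYPE('k::real_normed_field) X (\<Q> \<alpha>)) \<and>
           increasing_chain \<kappa> \<Q> \<and>
           (let Q = (\<lambda>\<alpha>. cfun0 X \<inter> zero_set_preimage X (\<Q> \<alpha>) :: ('a \<Rightarrow> 'k) set) in
              (\<forall>\<alpha>\<in>Field \<kappa>. cfun0_prime_ideal X (Q \<alpha>) \<and> cfun0_z_ideal X (Q \<alpha>)) \<and>
              increasing_chain \<kappa> Q)"
proof -
  have "completely_metrizable_space X"
    using assms(1) by (simp add: polish_topology_def)
  then obtain M d where "Metric_space M d" and X: "X = Metric_space.mtopology M d"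
    unfolding completely_metrizable_space_def by metis
  interpret Metric_space M d
    by fact
  have zs: "zero_sets TYPE('k) X = {Z. closedin X Z}"
  proof (intro equalityI subsetI CollectI)
    fix Z assume "Z \<in> {Z. closedin X Z}"
    then obtain f :: "'a \<Rightarrow> 'k" where "f \<in> cfun X" "zero_set X f = Z"
      using closedin_imp_zero_set unfolding X by blast
    then show "Z \<in> zero_sets TYPE('k) X"
      using zero_set_in_zero_sets by blast
  qed (rule closedin_zero_sets)
  have "separable_space mtopology" "locally_compact_space mtopology" "uncountable M"
    using assms(1-3) unfolding X polish_topology_def by simp_all
  note ex_family = ex_independent_family[OF this eqpoll_imp_lepoll[OF assms(5)]]
  obtain E and Z :: "'i \<Rightarrow> 'a set" and K V
    where indep: "independent_family mtopology E (Field \<kappa>) Z" and K: "compactin mtopology K"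
      and V: "openin mtopology V" "V \<subseteq> K" "E \<subseteq> V"
      and Z: "\<And>i. closedin mtopology (Z i)" "\<And>i. M - V \<subseteq> Z i"
    by (rule ex_family) (rule that)
  have "Linear_order \<kappa>"
    using assms(4) by (simp add: well_order_on_def)
  from independent_family.limit_ultrafilter_exists[OF indep this refl, folded X]
  obtain U :: "('i \<Rightarrow> 'a) filter" where U: "U \<noteq> bot"
      "\<forall>P. eventually P U \<or> eventually (\<lambda>p. \<not> P p) U"
    and UE: "\<forall>\<alpha>\<in>Field \<kappa>. eventually (\<lambda>p. p \<alpha> \<in> E - Z \<alpha>) U"
    and Ule: "\<forall>\<alpha>\<in>Field \<kappa>. \<forall>\<beta>\<in>Field \<kappa>. (\<alpha>, \<beta>) \<in> \<kappa> \<and> \<alpha> \<noteq> \<beta> \<longrightarrow>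
       eventually (\<lambda>p. p \<beta> \<in> Z \<alpha>) U \<and>
       (\<forall>W. closedin X W \<longrightarrow> eventually (\<lambda>p. p \<alpha> \<in> W \<longrightarrow> p \<beta> \<in> W) U)"
    by (elim exE conjE) (rule that)
  have contra: False if "eventually P U" "eventually (\<lambda>p. \<not> P p) U" for P
    using eventually_conj[OF that] U(1) by (simp add: trivial_limit_def)
  have EX: "E \<subseteq> topspace X"
    using indep unfolding X independent_family_def by blast
  define \<Q> where "\<Q> \<alpha> = {W. closedin X W \<and> eventually (\<lambda>p. p \<alpha> \<in> W) U}" for \<alpha>
  define Q where "Q \<alpha> = (cfun0 X \<inter> zero_set_preimage X (\<Q> \<alpha>) :: ('a \<Rightarrow> 'k) set)" for \<alpha>
  have notin: "eventually (\<lambda>p. p \<alpha> \<notin> Z \<alpha>) U" if "\<alpha> \<in> Field \<kappa>" for \<alpha>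
    using UE[rule_format, OF that] by (rule eventually_mono) auto
  have prime: "prime_z_filter TYPE('k) X (\<Q> \<alpha>)" if "\<alpha> \<in> Field \<kappa>" for \<alpha>
    unfolding \<Q>_def
  proof (rule prime_z_filter_ultrafilter_limit[OF zs U(1) U(2)[rule_format]])
    show "eventually (\<lambda>p. p \<alpha> \<in> topspace X) U"
      using UE[rule_format, OF that] by (rule eventually_mono) (use EX in auto)
    show "closedin X (Z \<alpha>)"
      using Z by (simp add: X)
  qed (rule notin[OF that])
  have le: "\<Q> \<alpha> \<subseteq> \<Q> \<beta>"
    if "\<alpha> \<in> Field \<kappa>" "\<beta> \<in> Field \<kappa>" "(\<alpha>, \<beta>) \<in> \<kappa> \<and> \<alpha> \<noteq> \<beta>" for \<alpha> \<beta>
  proof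
    fix W assume W: "W \<in> \<Q> \<alpha>"
    then have "eventually (\<lambda>p. p \<alpha> \<in> W) U" "eventually (\<lambda>p. p \<alpha> \<in> W \<longrightarrow> p \<beta> \<in> W) U"
      using Ule that unfolding \<Q>_def by blast+
    then have "eventually (\<lambda>p. p \<beta> \<in> W) U"
      by eventually_elim auto
    with W show "W \<in> \<Q> \<beta>"
      by (simp add: \<Q>_def)
  qed
  \<comment> \<open>\<open>Z \<alpha>\<close> separates the \<open>\<alpha>\<close>-th filter from
    all later ones, which makes the inclusions strict.\<close>
  have Z_notin: "Z \<alpha> \<notin> \<Q> \<alpha>" if "\<alpha> \<in> Field \<kappa>" for \<alpha>
    using notin[OF that] contra by (auto simp: \<Q>_def)
  have Z_in: "Z \<alpha> \<in> \<Q> \<beta>"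
    if "\<alpha> \<in> Field \<kappa>" "\<beta> \<in> Field \<kappa>" "(\<alpha>, \<beta>) \<in> \<kappa> \<and> \<alpha> \<noteq> \<beta>" for \<alpha> \<beta>
    using Ule that Z(1) unfolding \<Q>_def X by blast
  \<comment> \<open>Strictness must survive the restriction to functions vanishing at infinity. As
    \<open>Z \<alpha>\<close> contains everything outside \<open>K\<close>, the same
    \<open>K\<close> serves every \<open>\<epsilon>\<close>. This function also shows that the ideal
    is proper.\<close>
  have ex_f: "\<exists>f \<in> cfun0 X :: ('a \<Rightarrow> 'k) set. zero_set X f = Z \<alpha>" for \<alpha>
  proof -
    obtain f :: "'a \<Rightarrow> 'k" where f: "f \<in> cfun X" "zero_set X f = Z \<alpha>"
      using closedin_imp_zero_set[OF Z(1)] unfolding X by blast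
    have "f x = 0" if "x \<in> topspace X - K" for x
    proof -
      have "x \<in> zero_set X f"
        using that f(2) Z(2) V(2) by (auto simp: X)
      then show ?thesis
        by (simp add: zero_set_def)
    qed
    then have "f \<in> cfun0 X"
      using f(1) K unfolding cfun0_def X by (auto intro!: exI[of _ K])
    with f(2) show ?thesis by blast
  qed
  have memQ: "f \<in> Q \<alpha> \<longleftrightarrow> f \<in> cfun0 X \<and> zero_set X f \<in> \<Q> \<alpha>" for f \<alpha>
    by (auto simp: Q_def zero_set_preimage_def cfun0_def)
  have "increasing_chain \<kappa> \<Q>"
    unfolding increasing_chain_def using le Z_in Z_notin by blast
  moreover have "increasing_chain \<kappa> Q"
    unfolding increasing_chain_def
  proof (intro ballI impI)
    fix \<alpha> \<beta> assume *: "\<alpha> \<in> Field \<kappa>" "\<beta> \<in> Field \<kappa>" "(\<alpha>, \<beta>) \<in> \<kappa> \<and> \<alpha> \<noteq> \<beta>"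
    obtain f :: "'a \<Rightarrow> 'k" where "f \<in> cfun0 X" "zero_set X f = Z \<alpha>"
      using ex_f by blast
    then have "f \<in> Q \<beta>" "f \<notin> Q \<alpha>"
      using Z_in[OF *] Z_notin[OF *(1)] by (auto simp: memQ)
    moreover have "Q \<alpha> \<subseteq> Q \<beta>"
      using le[OF *] by (auto simp: memQ)
    ultimately show "Q \<alpha> \<subset> Q \<beta>"
      by blast
  qed
  moreover have "cfun0_prime_ideal X (Q \<alpha>) \<and> cfun0_z_ideal X (Q \<alpha>)" if "\<alpha> \<in> Field \<kappa>" for \<alpha>
    using prime_z_filter_imp_ideal[OF prime[OF that]] ex_f[of \<alpha>] Z_notin[OF that]
    unfolding Q_def by metis
  ultimately show ?thesis
    using prime unfolding Let_def Q_def by blast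
qed

end
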